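(* Let $(G,m)$ be a summable weighted graph without isolated vertices, let $\sigma(\Delta)\subset[0,2]$ be the spectrum of its normalised Laplacian, and let $\mathcal R:[0,2]\to[0,2]$ be the reflection $\mathcal R(x)=2-x$. Then the Hausdorff distance satisfies \[ d_H\big(\sigma(\Delta),\mathcal R(\sigma(\Delta))\big)\le 2\,\kappa(G,m). \]
   Context: A weighted graph $(G,m)$ consists of a countable simple graph $G$ (vertex set $V(G)$ finite or countably infinite) and a function $m:E(G)\to(0,\infty)$; it is summable if $\sum_{e\in E(G)}m(e)<\infty$. Write $m(vw)=m(\{v,w\})$ if $\{v,w\}\in E(G)$ and $m(vw)=0$ otherwise; $m(v)=\sum_w m(vw)>0$ (no isolated vertices). $L^2(G,m)$ is the real Hilbert space of $f:V(G)\to\mathbb R$ with $\sum_v m(v)f(v)^2<\infty$, inner product $\langle f,g\rangle=\sum_v m(v)f(v)g(v)$. The normalised Laplacian is $(\Delta f)(v)=f(v)-\sum_w\frac{m(vw)}{m(v)}f(w)$, and its spectrum lies in $[0,2]$. For $v\in V(G)$ and $S\subset V(G)$ put $p_S(v)=\frac{1}{m(v)}\sum_{w\in S}m(vw)$. For a partition $V(G)=A\sqcup B$ into two nonempty sets, $\kappa(A,B)=\max\{\sup_{v\in A}p_A(v),\sup_{w\in B}p_B(w)\}$, and $\kappa(G,m)=\inf\kappa(A,B)$ over all such partitions. The Hausdorff distance of nonempty $X,Y\subset\mathbb R$ is $d_H(X,Y)=\max\{\sup_{x\in X}d(x,Y),\sup_{y\in Y}d(X,y)\}$. *)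

theory Defs
  imports "HOL-Analysis.Analysis"
begin

text \<open>
  A graph is given by a vertex set \<open>V\<close> and a set \<open>E\<close> of two-element subsets of \<open>V\<close>; the weight
  function \<open>m\<close> is only relevant on \<open>E\<close>. Graphs are nonempty, since the Hausdorff distance is only
  considered between nonempty sets.
\<close>

definition weighted_graph :: "'a set \<Rightarrow> 'a set set \<Rightarrow> ('a set \<Rightarrow> real) \<Rightarrow> bool" where
  "weighted_graph V E m \<longleftrightarrow>
     countable V \<and> V \<noteq> {} \<and> (\<forall>e\<in>E. e \<subseteq> V \<and> card e = 2) \<and> (\<forall>e\<in>E. m e > 0)"

definition summable_weighted_graph :: "'a set \<Rightarrow> 'a set set \<Rightarrow> ('a set \<Rightarrow> real) \<Rightarrow> bool" where
  "summable_weighted_graph V E m \<longleftrightarrow> weighted_graph V E m \<and> m summable_on E"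

definition no_isolated_vertices :: "'a set \<Rightarrow> 'a set set \<Rightarrow> bool" where
  "no_isolated_vertices V E \<longleftrightarrow> (\<forall>v\<in>V. \<exists>w\<in>V. {v, w} \<in> E)"

definition edge_weight :: "'a set set \<Rightarrow> ('a set \<Rightarrow> real) \<Rightarrow> 'a \<Rightarrow> 'a \<Rightarrow> real" where
  "edge_weight E m v w = (if {v, w} \<in> E then m {v, w} else 0)"

definition vertex_weight :: "'a set \<Rightarrow> 'a set set \<Rightarrow> ('a set \<Rightarrow> real) \<Rightarrow> 'a \<Rightarrow> real" where
  "vertex_weight V E m v = (\<Sum>\<^sub>\<infinity>w\<in>V. edge_weight E m v w)"

text \<open>
  A function on \<open>V\<close> is represented by the function on the whole type that vanishes outside \<open>V\<close>.
\<close>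

definition L2 :: "'a set \<Rightarrow> 'a set set \<Rightarrow> ('a set \<Rightarrow> real) \<Rightarrow> ('a \<Rightarrow> real) set" where
  "L2 V E m = {f. (\<forall>v. v \<notin> V \<longrightarrow> f v = 0) \<and> (\<lambda>v. vertex_weight V E m v * (f v)\<^sup>2) summable_on V}"

definition L2_inner ::
    "'a set \<Rightarrow> 'a set set \<Rightarrow> ('a set \<Rightarrow> real) \<Rightarrow> ('a \<Rightarrow> real) \<Rightarrow> ('a \<Rightarrow> real) \<Rightarrow> real" where
  "L2_inner V E m f g = (\<Sum>\<^sub>\<infinity>v\<in>V. vertex_weight V E m v * f v * g v)"

definition L2_norm :: "'a set \<Rightarrow> 'a set set \<Rightarrow> ('a set \<Rightarrow> real) \<Rightarrow> ('a \<Rightarrow> real) \<Rightarrow> real" where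
  "L2_norm V E m f = sqrt (L2_inner V E m f f)"

definition L2_bounded_operator ::
    "'a set \<Rightarrow> 'a set set \<Rightarrow> ('a set \<Rightarrow> real) \<Rightarrow> (('a \<Rightarrow> real) \<Rightarrow> ('a \<Rightarrow> real)) \<Rightarrow> bool" where
  "L2_bounded_operator V E m T \<longleftrightarrow>
     (\<forall>f\<in>L2 V E m. T f \<in> L2 V E m) \<and>
     (\<forall>f\<in>L2 V E m. \<forall>g\<in>L2 V E m. T (\<lambda>v. f v + g v) = (\<lambda>v. T f v + T g v)) \<and>
     (\<forall>c. \<forall>f\<in>L2 V E m. T (\<lambda>v. c * f v) = (\<lambda>v. c * T f v)) \<and>
     (\<exists>K. \<forall>f\<in>L2 V E m. L2_norm V E m (T f) \<le> K * L2_norm V E m f)"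

text \<open>
  The spectrum of an operator on the real Hilbert space: the real numbers \<open>x\<close> for which
  \<open>T - x I\<close> has no bounded inverse. For self-adjoint \<open>T\<close> this is also the spectrum of the
  complexification.
\<close>

definition L2_spectrum ::
    "'a set \<Rightarrow> 'a set set \<Rightarrow> ('a set \<Rightarrow> real) \<Rightarrow> (('a \<Rightarrow> real) \<Rightarrow> ('a \<Rightarrow> real)) \<Rightarrow> real set" where
  "L2_spectrum V E m T =
     {x. \<not> (\<exists>S. L2_bounded_operator V E m S \<and>
              (\<forall>f\<in>L2 V E m. S (\<lambda>v. T f v - x * f v) = f \<and>
                            (\<lambda>v. T (S f) v - x * S f v) = f))}"

definition laplacian ::
    "'a set \<Rightarrow> 'a set set \<Rightarrow> ('a set \<Rightarrow> real) \<Rightarrow> ('a \<Rightarrow> real) \<Rightarrow> ('a \<Rightarrow> real)" where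
  "laplacian V E m f = (\<lambda>v. if v \<in> V
     then f v - (\<Sum>\<^sub>\<infinity>w\<in>V. edge_weight E m v w / vertex_weight V E m v * f w) else 0)"

definition trans_prob ::
    "'a set \<Rightarrow> 'a set set \<Rightarrow> ('a set \<Rightarrow> real) \<Rightarrow> 'a set \<Rightarrow> 'a \<Rightarrow> real" where
  "trans_prob V E m S v = 1 / vertex_weight V E m v * (\<Sum>\<^sub>\<infinity>w\<in>S. edge_weight E m v w)"

definition kappa_partition ::
    "'a set \<Rightarrow> 'a set set \<Rightarrow> ('a set \<Rightarrow> real) \<Rightarrow> 'a set \<Rightarrow> 'a set \<Rightarrow> real" where
  "kappa_partition V E m A B =
     max (SUP v\<in>A. trans_prob V E m A v) (SUP w\<in>B. trans_prob V E m B w)"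

definition kappa :: "'a set \<Rightarrow> 'a set set \<Rightarrow> ('a set \<Rightarrow> real) \<Rightarrow> real" where
  "kappa V E m = Inf {kappa_partition V E m A B | A B.
     A \<union> B = V \<and> A \<inter> B = {} \<and> A \<noteq> {} \<and> B \<noteq> {}}"

definition hausdorff_distance :: "real set \<Rightarrow> real set \<Rightarrow> real" where
  "hausdorff_distance X Y = max (SUP x\<in>X. infdist x Y) (SUP y\<in>Y. infdist y X)"

definition reflection :: "real \<Rightarrow> real" where
  "reflection x = 2 - x"

end

theory Submission
  imports Defs
begin

text \<open>
  Write \<open>\<Delta> = 1 - P\<close> and let \<open>D\<close> be the operator of multiplication by \<open>1\<close> on \<open>A\<close> and \<open>-1\<close> on \<open>B\<close>. Then
  \<open>D \<Delta> D = (2 - \<Delta>) - 2 P'\<close>, where \<open>P'\<close> keeps only the transitions inside the parts, and Schur's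
  test bounds the norm of \<open>P'\<close> by \<open>\<kappa>(A, B)\<close>. Hence \<open>D\<close> sends an \<open>\<epsilon>\<close>-approximate eigenvector of \<open>\<Delta>\<close>
  for \<open>x\<close> to an \<open>(\<epsilon> + 2 \<kappa>(A, B))\<close>-approximate eigenvector for \<open>2 - x\<close>. For a self-adjoint operator,
  spectral points have \<open>\<epsilon>\<close>-approximate eigenvectors for every \<open>\<epsilon> > 0\<close>, and conversely a
  \<open>\<delta>\<close>-approximate eigenvector for \<open>y\<close> forces a spectral point within any distance \<open>> \<delta>\<close> of \<open>y\<close>.
\<close>

section \<open>Self-adjoint operators on a Hilbert space of functions\<close>

text \<open>Definiteness is left out so that Cauchy-Schwarz also serves the form
  \<open>ip (Q f) g\<close> of a positive operator \<open>Q\<close> and weighted sums whose weights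
  may vanish.\<close>

locale semi_inner_space =
  fixes H :: "('a \<Rightarrow> real) set" and ip :: "('a \<Rightarrow> real) \<Rightarrow> ('a \<Rightarrow> real) \<Rightarrow> real"
  assumes add_mem: "f \<in> H \<Longrightarrow> g \<in> H \<Longrightarrow> (\<lambda>v. f v + g v) \<in> H"
    and scale_mem: "f \<in> H \<Longrightarrow> (\<lambda>v. c * f v) \<in> H"
    and ip_add: "f \<in> H \<Longrightarrow> g \<in> H \<Longrightarrow> h \<in> H \<Longrightarrow> ip (\<lambda>v. f v + g v) h = ip f h + ip g h"
    and ip_scale: "f \<in> H \<Longrightarrow> g \<in> H \<Longrightarrow> ip (\<lambda>v. c * f v) g = c * ip f g"
    and ip_sym: "f \<in> H \<Longrightarrow> g \<in> H \<Longrightarrow> ip f g = ip g f"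
    and ip_nonneg: "f \<in> H \<Longrightarrow> 0 \<le> ip f f"
begin

lemma diff_mem: "f \<in> H \<Longrightarrow> g \<in> H \<Longrightarrow> (\<lambda>v. f v - g v) \<in> H"
  using add_mem[of f "\<lambda>v. -1 * g v"] scale_mem[of g "-1"] by simp

lemma ip_diff:
  assumes "f \<in> H" "g \<in> H" "h \<in> H"
  shows "ip (\<lambda>v. f v - g v) h = ip f h - ip g h"
  using ip_add[OF assms(1) scale_mem[OF assms(2), of "-1"] assms(3)]
    ip_scale[OF assms(2,3), of "-1"] by simp

lemma ip_add_right:
  "f \<in> H \<Longrightarrow> g \<in> H \<Longrightarrow> h \<in> H \<Longrightarrow> ip h (\<lambda>v. f v + g v) = ip h f + ip h g"
  using ip_add[of f g h] add_mem[of f g] ip_sym[of h] by metis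

lemma ip_scale_right: "f \<in> H \<Longrightarrow> g \<in> H \<Longrightarrow> ip g (\<lambda>v. c * f v) = c * ip g f"
  using ip_scale[of f g c] scale_mem[of f c] ip_sym[of g] by metis

lemma ip_diff_right:
  "f \<in> H \<Longrightarrow> g \<in> H \<Longrightarrow> h \<in> H \<Longrightarrow> ip h (\<lambda>v. f v - g v) = ip h f - ip h g"
  using ip_diff[of f g h] diff_mem[of f g] ip_sym[of h] by metis

lemmas mem_intros = add_mem diff_mem scale_mem
lemmas ip_simps = ip_add ip_diff ip_scale ip_add_right ip_diff_right ip_scale_right mem_intros

lemma Cauchy_Schwarz:
  assumes f: "f \<in> H" and g: "g \<in> H"
  shows "(ip f g)\<^sup>2 \<le> ip f f * ip g g"
proof -
  \<comment> \<open>Cauchy-Schwarz is read off from this polynomial in \<open>t\<close>, which is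
    nonnegative everywhere: if it is affine, its slope must vanish; otherwise it is evaluated at its
    minimiser.\<close>
  have expand: "0 \<le> ip f f + 2 * t * ip f g + t\<^sup>2 * ip g g" for t
  proof -
    have "0 \<le> ip (\<lambda>v. f v + t * g v) (\<lambda>v. f v + t * g v)"
      using f g by (intro ip_nonneg mem_intros)
    also have "\<dots> = ip f f + 2 * t * ip f g + t\<^sup>2 * ip g g"
      using f g by (simp add: ip_simps ip_sym[OF g f] power2_eq_square algebra_simps)
    finally show ?thesis .
  qed
  show ?thesis
  proof (cases "ip g g = 0")
    case True
    have "ip f g = 0"
    proof (rule ccontr)
      assume "ip f g \<noteq> 0"
      then have "2 * ((- ip f f - 1) / (2 * ip f g)) * ip f g = - ip f f - 1" by simp
      then obtain t where "2 * t * ip f g = - ip f f - 1" by blast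
      then show False using expand[of t] True by simp
    qed
    then show ?thesis using True by simp
  next
    case False
    then have "0 < ip g g" using ip_nonneg[OF g] by simp
    then show ?thesis
      using expand[of "- ip f g / ip g g"] by (simp add: field_simps power2_eq_square)
  qed
qed

definition nrm :: "('a \<Rightarrow> real) \<Rightarrow> real" where
  "nrm f = sqrt (ip f f)"

lemma nrm_nonneg: "f \<in> H \<Longrightarrow> 0 \<le> nrm f"
  by (simp add: nrm_def ip_nonneg)

lemma nrm_square: "f \<in> H \<Longrightarrow> (nrm f)\<^sup>2 = ip f f"
  by (simp add: nrm_def ip_nonneg)

lemma ip_le_nrm:
  assumes "f \<in> H" "g \<in> H"
  shows "\<bar>ip f g\<bar> \<le> nrm f * nrm g"
proof (rule power2_le_imp_le)
  show "\<bar>ip f g\<bar>\<^sup>2 \<le> (nrm f * nrm g)\<^sup>2"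
    using Cauchy_Schwarz[OF assms] assms by (simp add: power_mult_distrib nrm_square)
qed (use assms in \<open>simp add: nrm_nonneg\<close>)

lemma nrm_triangle:
  assumes f: "f \<in> H" and g: "g \<in> H"
  shows "nrm (\<lambda>v. f v + g v) \<le> nrm f + nrm g"
proof (rule power2_le_imp_le)
  have "(nrm (\<lambda>v. f v + g v))\<^sup>2 = (nrm f)\<^sup>2 + 2 * ip f g + (nrm g)\<^sup>2"
    using f g by (simp add: nrm_square ip_simps ip_sym[OF g f])
  also have "\<dots> \<le> (nrm f + nrm g)\<^sup>2"
    using ip_le_nrm[OF f g] by (simp add: power2_sum)
  finally show "(nrm (\<lambda>v. f v + g v))\<^sup>2 \<le> (nrm f + nrm g)\<^sup>2" .
qed (use f g in \<open>simp add: nrm_nonneg\<close>)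

lemma nrm_scale: "f \<in> H \<Longrightarrow> nrm (\<lambda>v. c * f v) = \<bar>c\<bar> * nrm f"
  by (simp add: nrm_def ip_simps real_sqrt_mult)

lemma nrm_diff_triangle:
  assumes "f \<in> H" "g \<in> H"
  shows "nrm (\<lambda>v. f v - g v) \<le> nrm f + nrm g"
  using nrm_triangle[OF assms(1) scale_mem[OF assms(2), of "-1"]] nrm_scale[OF assms(2), of "-1"]
  by simp

lemma nrm_diff_commute:
  assumes "f \<in> H" "g \<in> H"
  shows "nrm (\<lambda>v. f v - g v) = nrm (\<lambda>v. g v - f v)"
  using nrm_scale[OF diff_mem[OF assms], of "-1"] by simp

section \<open>Bounded, self-adjoint and positive operators\<close>

definition bounded_operator :: "(('a \<Rightarrow> real) \<Rightarrow> ('a \<Rightarrow> real)) \<Rightarrow> bool" where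
  "bounded_operator T \<longleftrightarrow>
     (\<forall>f\<in>H. T f \<in> H) \<and>
     (\<forall>f\<in>H. \<forall>g\<in>H. T (\<lambda>v. f v + g v) = (\<lambda>v. T f v + T g v)) \<and>
     (\<forall>c. \<forall>f\<in>H. T (\<lambda>v. c * f v) = (\<lambda>v. c * T f v)) \<and>
     (\<exists>K. \<forall>f\<in>H. nrm (T f) \<le> K * nrm f)"

definition self_adjoint :: "(('a \<Rightarrow> real) \<Rightarrow> ('a \<Rightarrow> real)) \<Rightarrow> bool" where
  "self_adjoint T \<longleftrightarrow> (\<forall>f\<in>H. \<forall>g\<in>H. ip (T f) g = ip f (T g))"

definition bounded_below :: "(('a \<Rightarrow> real) \<Rightarrow> ('a \<Rightarrow> real)) \<Rightarrow> bool" where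
  "bounded_below T \<longleftrightarrow> (\<exists>c>0. \<forall>f\<in>H. c * nrm f \<le> nrm (T f))"

definition invertible_operator :: "(('a \<Rightarrow> real) \<Rightarrow> ('a \<Rightarrow> real)) \<Rightarrow> bool" where
  "invertible_operator T \<longleftrightarrow>
     (\<exists>S. bounded_operator S \<and> (\<forall>f\<in>H. S (T f) = f \<and> T (S f) = f))"

definition shift :: "(('a \<Rightarrow> real) \<Rightarrow> ('a \<Rightarrow> real)) \<Rightarrow> real \<Rightarrow> ('a \<Rightarrow> real) \<Rightarrow> ('a \<Rightarrow> real)" where
  "shift T x f = (\<lambda>v. T f v - x * f v)"

lemma op_mem: "bounded_operator T \<Longrightarrow> f \<in> H \<Longrightarrow> T f \<in> H"
  and op_add: "bounded_operator T \<Longrightarrow> f \<in> H \<Longrightarrow> g \<in> H \<Longrightarrow>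
    T (\<lambda>v. f v + g v) = (\<lambda>v. T f v + T g v)"
  and op_scale: "bounded_operator T \<Longrightarrow> f \<in> H \<Longrightarrow> T (\<lambda>v. c * f v) = (\<lambda>v. c * T f v)"
  by (auto simp: bounded_operator_def)

lemma op_diff:
  assumes "bounded_operator T" "f \<in> H" "g \<in> H"
  shows "T (\<lambda>v. f v - g v) = (\<lambda>v. T f v - T g v)"
  using op_add[OF assms(1,2) scale_mem[OF assms(3), of "-1"]] op_scale[OF assms(1,3), of "-1"]
  by simp

text \<open>Raising the constant to at least \<open>1\<close> allows later proofs to divide by
  it.\<close>

lemma bounded_operator_bound:
  assumes "bounded_operator T"
  obtains K where "0 < K" "\<And>f. f \<in> H \<Longrightarrow> nrm (T f) \<le> K * nrm f"
proof -
  obtain K where K: "\<And>f. f \<in> H \<Longrightarrow> nrm (T f) \<le> K * nrm f"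
    using assms unfolding bounded_operator_def by blast
  show thesis
  proof (rule that[of "max 1 K"])
    fix f assume f: "f \<in> H"
    have "K * nrm f \<le> max 1 K * nrm f"
      by (intro mult_right_mono nrm_nonneg f) simp
    then show "nrm (T f) \<le> max 1 K * nrm f" using K[OF f] by simp
  qed simp
qed

lemma bounded_operator_shift:
  assumes T: "bounded_operator T"
  shows "bounded_operator (shift T x)"
proof -
  obtain K where K: "\<And>f. f \<in> H \<Longrightarrow> nrm (T f) \<le> K * nrm f"
    using bounded_operator_bound[OF T] by blast
  have "nrm (shift T x f) \<le> (K + \<bar>x\<bar>) * nrm f" if f: "f \<in> H" for f
    using nrm_diff_triangle[OF op_mem[OF T f] scale_mem[OF f, of x]] K[OF f] nrm_scale[OF f, of x]
    by (simp add: shift_def algebra_simps)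
  then have "\<exists>K. \<forall>f\<in>H. nrm (shift T x f) \<le> K * nrm f" by blast
  then show ?thesis
    unfolding bounded_operator_def
    by (auto simp: shift_def op_add[OF T] op_scale[OF T] algebra_simps op_mem[OF T] mem_intros)
qed

lemma self_adjoint_shift:
  assumes "bounded_operator T" "self_adjoint T"
  shows "self_adjoint (shift T x)"
  using assms unfolding self_adjoint_def shift_def by (auto simp: ip_simps op_mem)

lemma bounded_operator_id_minus:
  assumes T: "bounded_operator T" and L: "\<And>f. f \<in> H \<Longrightarrow> L f = (\<lambda>v. f v - T f v)"
  shows "bounded_operator L"
proof -
  obtain K where K: "\<And>f. f \<in> H \<Longrightarrow> nrm (T f) \<le> K * nrm f"
    using bounded_operator_bound[OF T] by blast
  have "nrm (L f) \<le> (1 + K) * nrm f" if f: "f \<in> H" for f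
    using nrm_diff_triangle[OF f op_mem[OF T f]] K[OF f] by (simp add: L f algebra_simps)
  then have "\<exists>K. \<forall>f\<in>H. nrm (L f) \<le> K * nrm f" by blast
  then show ?thesis
    unfolding bounded_operator_def
    by (auto simp: L op_add[OF T] op_scale[OF T] op_mem[OF T] mem_intros algebra_simps)
qed

lemma self_adjoint_id_minus:
  assumes "bounded_operator T" "self_adjoint T" "\<And>f. f \<in> H \<Longrightarrow> L f = (\<lambda>v. f v - T f v)"
  shows "self_adjoint L"
  using assms unfolding self_adjoint_def by (auto simp: ip_simps op_mem)

text \<open>Cauchy-Schwarz for the form \<open>ip (Q f) g\<close>, applied to \<open>f\<close> and
  \<open>Q f\<close>, bounds the square of \<open>ip (Q f) (Q f)\<close> by
  \<open>ip (Q f) f\<close> times \<open>q * ip (Q f) (Q f)\<close>, and one factor cancels. It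
  yields the spectral gap in \<open>not_bounded_below_near_zero\<close> and the contraction in
  \<open>bounded_below_imp_surj\<close>.\<close>

lemma positive_operator_bound:
  assumes Q: "\<And>f. f \<in> H \<Longrightarrow> Q f \<in> H"
      "\<And>f g. f \<in> H \<Longrightarrow> g \<in> H \<Longrightarrow> Q (\<lambda>v. f v + g v) = (\<lambda>v. Q f v + Q g v)"
      "\<And>c f. f \<in> H \<Longrightarrow> Q (\<lambda>v. c * f v) = (\<lambda>v. c * Q f v)"
    and sym: "self_adjoint Q"
    and pos: "\<And>f. f \<in> H \<Longrightarrow> 0 \<le> ip (Q f) f"
    and le: "\<And>f. f \<in> H \<Longrightarrow> ip (Q f) f \<le> q * ip f f"
    and f: "f \<in> H"
  shows "ip (Q f) (Q f) \<le> q * ip (Q f) f"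
proof -
  interpret B: semi_inner_space H "\<lambda>f g. ip (Q f) g"
  proof
    show "ip (Q f) g = ip (Q g) f" if "f \<in> H" "g \<in> H" for f g
      using sym that ip_sym[OF that(1) Q(1)[OF that(2)]] by (simp add: self_adjoint_def)
  qed (simp_all add: Q pos ip_simps)
  let ?n = "ip (Q f) (Q f)"
  have "?n\<^sup>2 \<le> ip (Q f) f * ip (Q (Q f)) (Q f)"
    using B.Cauchy_Schwarz[OF f Q(1)[OF f]] by simp
  also have "\<dots> \<le> ip (Q f) f * (q * ?n)"
    by (intro mult_left_mono le Q pos f)
  finally have *: "?n * ?n \<le> ?n * (q * ip (Q f) f)"
    by (simp add: power2_eq_square algebra_simps)
  show ?thesis
  proof (cases "?n = 0")
    case False
    then show ?thesis using * ip_nonneg[OF Q(1)[OF f]] by simp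
  next
    case True
    \<comment> \<open>Nothing can be cancelled here, but the right-hand side is nonnegative: either
      \<open>ip f f = 0\<close> forces \<open>ip (Q f) f = 0\<close>, or the two bounds on
      \<open>ip (Q f) f\<close> force \<open>0 \<le> q\<close>.\<close>
    have "0 \<le> q * ip (Q f) f"
    proof (cases "ip f f = 0")
      case True
      then show ?thesis using pos[OF f] le[OF f] by simp
    next
      case False
      then have "0 < ip f f" using ip_nonneg[OF f] by simp
      then have "0 \<le> q" using order_trans[OF pos[OF f] le[OF f]]
        by (simp add: zero_le_mult_iff)
      then show ?thesis using pos[OF f] by simp
    qed
    then show ?thesis using True by simp
  qed
qed

text \<open>With \<open>s\<close> the infimum of the Rayleigh quotient of \<open>T\<^sup>2\<close>, the positive operator
  \<open>T\<^sup>2 - s = (T - \<surd>s) (T + \<surd>s)\<close> is not bounded below, so one of the two factors is not.\<close>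

lemma not_bounded_below_near_zero:
  assumes T: "bounded_operator T" "self_adjoint T"
    and f0: "f0 \<in> H" "nrm f0 \<noteq> 0" "nrm (T f0) < \<delta> * nrm f0"
  obtains t where "\<bar>t\<bar> < \<delta>" "\<not> bounded_below (shift T t)"
proof (rule ccontr)
  assume "\<not> thesis"
  then have below: "bounded_below (shift T t)" if "\<bar>t\<bar> < \<delta>" for t
    using that \<open>\<And>t. \<bar>t\<bar> < \<delta> \<Longrightarrow> \<not> bounded_below (shift T t) \<Longrightarrow> thesis\<close> by blast
  define N where "N = {f \<in> H. nrm f \<noteq> 0}"
  \<comment> \<open>By self-adjointness this is the Rayleigh quotient of the square of
    \<open>T\<close>.\<close>
  define \<rho> where "\<rho> f = (nrm (T f) / nrm f)\<^sup>2" for f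
  define s where "s = Inf (\<rho> ` N)"
  have N0: "f0 \<in> N" using f0 by (simp add: N_def)
  have bdd: "bdd_below (\<rho> ` N)"
    by (rule bdd_belowI[of _ 0]) (auto simp: \<rho>_def)
  have s0: "0 \<le> s"
    unfolding s_def by (rule cInf_greatest) (use N0 in \<open>auto simp: \<rho>_def\<close>)
  have nrm0: "0 < nrm f0" using f0 nrm_nonneg[of f0] by simp
  have "s \<le> \<rho> f0" unfolding s_def using N0 bdd by (intro cInf_lower) auto
  have quot: "nrm (T f0) / nrm f0 < \<delta>" "0 \<le> nrm (T f0) / nrm f0"
    using f0(3) nrm0 nrm_nonneg[OF op_mem[OF T(1) f0(1)]] by (simp_all add: field_simps)
  then have d0: "0 < \<delta>" by linarith
  have "\<rho> f0 < \<delta>\<^sup>2"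
    unfolding \<rho>_def by (rule power_strict_mono[OF quot]) simp
  then have "s < \<delta>\<^sup>2" using \<open>s \<le> \<rho> f0\<close> by simp
  define r where "r = sqrt s"
  have r: "r\<^sup>2 = s" "0 \<le> r" "r < \<delta>"
    using s0 \<open>s < \<delta>\<^sup>2\<close> d0 by (auto simp: r_def real_less_lsqrt)
  \<comment> \<open>Both \<open>r\<close> and \<open>-r\<close> lie within \<open>\<delta>\<close>
    of \<open>0\<close>, so under the assumption to be refuted both factors of \<open>Q\<close> are
    bounded below.\<close>
  obtain a where a: "0 < a" "\<And>f. f \<in> H \<Longrightarrow> a * nrm f \<le> nrm (shift T r f)"
    using below[of r] r by (auto simp: bounded_below_def)
  obtain b where b: "0 < b" "\<And>f. f \<in> H \<Longrightarrow> b * nrm f \<le> nrm (shift T (-r) f)"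
    using below[of "-r"] r by (auto simp: bounded_below_def)
  obtain K where K: "0 < K" "\<And>f. f \<in> H \<Longrightarrow> nrm (T f) \<le> K * nrm f"
    using bounded_operator_bound[OF T(1)] by blast
  have s_le: "s * (nrm f)\<^sup>2 \<le> (nrm (T f))\<^sup>2" if f: "f \<in> H" for f
  proof (cases "nrm f = 0")
    case False
    then have "s \<le> \<rho> f"
      unfolding s_def using f bdd by (intro cInf_lower) (auto simp: N_def)
    then show ?thesis using False by (simp add: \<rho>_def field_simps)
  qed simp
  define Q where "Q f = (\<lambda>v. T (T f) v - s * f v)" for f
  have Q_mem: "Q f \<in> H" if "f \<in> H" for f
    using that by (auto simp: Q_def op_mem T mem_intros)
  have ip_Q: "ip (Q f) f = (nrm (T f))\<^sup>2 - s * (nrm f)\<^sup>2" if f: "f \<in> H" for f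
    using T(2) f by (simp add: Q_def ip_simps op_mem[OF T(1)] nrm_square self_adjoint_def)
  have Q_shift: "Q f = shift T r (shift T (-r) f)" if f: "f \<in> H" for f
    using f r(1) op_add[OF T(1) op_mem[OF T(1) f] scale_mem[OF f, of r]] op_scale[OF T(1) f, of r]
    by (auto simp: Q_def shift_def fun_eq_iff algebra_simps power2_eq_square)
  \<comment> \<open>This turns a lower bound for the norm of \<open>Q f\<close> into one for
    \<open>ip (Q f) f\<close>, the excess of the Rayleigh quotient over \<open>s\<close>.\<close>
  have Q_bound: "ip (Q f) (Q f) \<le> K\<^sup>2 * ip (Q f) f" if f: "f \<in> H" for f
  proof (rule positive_operator_bound[OF Q_mem])
    show "self_adjoint Q"
      using T(2) by (auto simp: self_adjoint_def Q_def ip_simps op_mem[OF T(1)])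
    show "0 \<le> ip (Q f) f" if "f \<in> H" for f
      using s_le[OF that] ip_Q[OF that] by simp
    show "ip (Q f) f \<le> K\<^sup>2 * ip f f" if f: "f \<in> H" for f
    proof -
      have "(nrm (T f))\<^sup>2 \<le> (K * nrm f)\<^sup>2"
        using K f by (intro power_mono nrm_nonneg op_mem[OF T(1)])
      then show ?thesis
        using ip_Q[OF f] s0 by (simp add: power_mult_distrib nrm_square f)
          (smt (verit) f ip_nonneg mult_nonneg_nonneg)
    qed
  qed (auto simp: f Q_def op_add op_scale op_mem T algebra_simps)
  have Q_below: "a * b * nrm f \<le> nrm (Q f)" if f: "f \<in> H" for f
  proof -
    have mem: "shift T (-r) f \<in> H"
      by (rule op_mem[OF bounded_operator_shift[OF T(1)] f])
    have "a * b * nrm f \<le> a * nrm (shift T (-r) f)"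
      using a(1) b(2)[OF f] by (simp add: mult.assoc)
    also have "\<dots> \<le> nrm (Q f)" using a(2)[OF mem] Q_shift[OF f] by simp
    finally show ?thesis .
  qed
  \<comment> \<open>A uniform gap above the infimum \<open>s\<close>, which is the contradiction; it
    comes from dividing the chain below by the squares of \<open>K\<close> and
    \<open>nrm f\<close>.\<close>
  have "s + (a * b / K)\<^sup>2 \<le> \<rho> f" if "f \<in> N" for f
  proof -
    have f: "f \<in> H" "0 < nrm f" using that nrm_nonneg[of f] by (auto simp: N_def)
    have "(a * b * nrm f)\<^sup>2 \<le> (nrm (Q f))\<^sup>2"
      using a(1) b(1) f Q_below by (intro power_mono) auto
    also have "\<dots> \<le> K\<^sup>2 * ((nrm (T f))\<^sup>2 - s * (nrm f)\<^sup>2)"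
      using Q_bound[OF f(1)] ip_Q[OF f(1)] by (simp add: nrm_square Q_mem f(1))
    finally show ?thesis
      using f(2) K(1) by (simp add: \<rho>_def field_simps power_mult_distrib)
  qed
  then have "s + (a * b / K)\<^sup>2 \<le> s"
    unfolding s_def using N0 by (intro cInf_greatest) auto
  moreover have "0 < (a * b / K)\<^sup>2" using a(1) b(1) K(1) by simp
  ultimately show False by linarith
qed

section \<open>The spectrum near approximate eigenvalues\<close>

lemma invertible_imp_bounded_below:
  assumes "bounded_operator T" "invertible_operator T"
  shows "bounded_below T"
proof -
  obtain S where S: "bounded_operator S" "\<And>f. f \<in> H \<Longrightarrow> S (T f) = f"
    using assms(2) by (auto simp: invertible_operator_def)
  obtain K where K: "0 < K" "\<And>f. f \<in> H \<Longrightarrow> nrm (S f) \<le> K * nrm f"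
    using bounded_operator_bound[OF S(1)] by blast
  have "1 / K * nrm f \<le> nrm (T f)" if f: "f \<in> H" for f
    using K(2)[OF op_mem[OF assms(1) f]] S(2)[OF f] K(1) by (simp add: field_simps)
  then show ?thesis unfolding bounded_below_def using K(1) by (intro exI[of _ "1 / K"]) auto
qed

definition spectrum :: "(('a \<Rightarrow> real) \<Rightarrow> ('a \<Rightarrow> real)) \<Rightarrow> real set" where
  "spectrum T = {x. \<not> invertible_operator (shift T x)}"

text \<open>The result near zero is applied to \<open>shift T x\<close>: where a further shift by
  \<open>t\<close> is not bounded below, it has no bounded inverse, so \<open>x + t\<close> is
  spectral.\<close>

lemma spectrum_near_approximate_eigenvalue:
  assumes T: "bounded_operator T" "self_adjoint T"
    and f: "f \<in> H" "nrm f \<noteq> 0" "nrm (shift T x f) < \<delta> * nrm f"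
  obtains t where "t \<in> spectrum T" "\<bar>t - x\<bar> < \<delta>"
proof -
  obtain t where t: "\<bar>t\<bar> < \<delta>" "\<not> bounded_below (shift (shift T x) t)"
    using not_bounded_below_near_zero[OF bounded_operator_shift[OF T(1)] self_adjoint_shift[OF T] f]
    by blast
  have "shift (shift T x) t = shift T (x + t)"
    by (auto simp: shift_def fun_eq_iff algebra_simps)
  then have "x + t \<in> spectrum T"
    using t(2) invertible_imp_bounded_below[OF bounded_operator_shift[OF T(1)]]
    by (auto simp: spectrum_def)
  then show thesis using t(1) by (intro that[of "x + t"]) auto
qed

text \<open>If \<open>K\<close> bounds \<open>T\<close>, any vector of nonzero norm is an
  approximate eigenvector for \<open>0\<close> with error below \<open>K + 1\<close>.\<close>

lemma spectrum_nonempty: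
  assumes T: "bounded_operator T" "self_adjoint T" and f: "f \<in> H" "nrm f \<noteq> 0"
  shows "spectrum T \<noteq> {}"
proof -
  obtain K where K: "\<And>f. f \<in> H \<Longrightarrow> nrm (T f) \<le> K * nrm f"
    using bounded_operator_bound[OF T(1)] by blast
  have "nrm (shift T 0 f) < (K + 1) * nrm f"
    using K[OF f(1)] f(2) nrm_nonneg[OF f(1)] by (simp add: shift_def algebra_simps)
  then obtain t where "t \<in> spectrum T"
    by (rule spectrum_near_approximate_eigenvalue[OF T f])
  then show ?thesis by blast
qed

end

section \<open>Complete spaces: from lower bounds to invertibility\<close>

locale function_hilbert_space = semi_inner_space +
  assumes ip_definite: "f \<in> H \<Longrightarrow> ip f f = 0 \<Longrightarrow> f = (\<lambda>v. 0)"
    and complete: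
      "range X \<subseteq> H \<Longrightarrow> (\<forall>\<epsilon>>0. \<exists>M. \<forall>j k. M \<le> j \<longrightarrow> M \<le> k \<longrightarrow> nrm (\<lambda>v. X j v - X k v) < \<epsilon>) \<Longrightarrow>
        \<exists>f\<in>H. (\<lambda>n. nrm (\<lambda>v. X n v - f v)) \<longlonglongrightarrow> 0"
    and nonempty: "H \<noteq> {}"
begin

text \<open>Off \<open>H\<close> the distance is set to \<open>0\<close> because \<^locale>\<open>Metric_space\<close> demands
  nonnegativity and symmetry everywhere.\<close>

definition distance :: "('a \<Rightarrow> real) \<Rightarrow> ('a \<Rightarrow> real) \<Rightarrow> real" where
  "distance f g = (if f \<in> H \<and> g \<in> H then nrm (\<lambda>v. f v - g v) else 0)"

lemma nrm_eq_0: "f \<in> H \<Longrightarrow> nrm f = 0 \<Longrightarrow> f = (\<lambda>v. 0)"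
  using ip_definite by (simp add: nrm_def)

lemma nrm_zero: "nrm (\<lambda>v. 0) = 0"
  using nonempty nrm_scale[of _ 0] by auto

lemma Metric_space_distance: "Metric_space H distance"
proof
  fix f g h
  show "0 \<le> distance f g" by (simp add: distance_def nrm_nonneg mem_intros)
  show "distance f g = distance g f" using nrm_diff_commute[of f g] by (auto simp: distance_def)
  assume f: "f \<in> H" and g: "g \<in> H"
  show "distance f g = 0 \<longleftrightarrow> f = g"
    using nrm_eq_0[OF diff_mem[OF f g]] f g by (auto simp: distance_def nrm_zero fun_eq_iff)
  assume h: "h \<in> H"
  show "distance f h \<le> distance f g + distance g h"
    using nrm_triangle[OF diff_mem[OF f g] diff_mem[OF g h]] f g h by (simp add: distance_def)
qed

lemma mcomplete_distance: "Metric_space.mcomplete H distance"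
proof -
  interpret Metric_space H distance by (rule Metric_space_distance)
  show ?thesis
    unfolding mcomplete_def
  proof (intro allI impI)
    fix X assume "MCauchy X"
    then have X: "range X \<subseteq> H"
      and C: "\<forall>\<epsilon>>0. \<exists>M. \<forall>j k. M \<le> j \<longrightarrow> M \<le> k \<longrightarrow> distance (X j) (X k) < \<epsilon>"
      by (auto simp: MCauchy_def)
    have dist: "distance (X j) (X k) = nrm (\<lambda>v. X j v - X k v)" for j k
      using X by (auto simp: distance_def)
    obtain f where f: "f \<in> H" "(\<lambda>n. nrm (\<lambda>v. X n v - f v)) \<longlonglongrightarrow> 0"
      using complete[OF X] C unfolding dist by blast
    moreover have "distance (X n) f = nrm (\<lambda>v. X n v - f v)" for n
      using X f(1) by (auto simp: distance_def)
    ultimately show "\<exists>f. limitin mtopology X f sequentially"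
      unfolding limitin_metric_dist_null using X
      by (intro exI[of _ f]) (auto simp: image_subset_iff intro!: always_eventually)
  qed
qed

text \<open>The equation \<open>T\<^sup>2 f = g\<close> says that \<open>f\<close> is a fixed point of \<open>f \<mapsto> R f + K\<^sup>-\<^sup>2 g\<close> with
  \<open>R = 1 - K\<^sup>-\<^sup>2 T\<^sup>2\<close>, and \<open>R\<close> is a contraction when \<open>c \<le> \<bar>T\<bar> \<le> K\<close>.\<close>

lemma bounded_below_imp_surj:
  assumes T: "bounded_operator T" "self_adjoint T" "bounded_below T" and g: "g \<in> H"
  obtains f where "f \<in> H" "T f = g"
proof -
  obtain K where K: "0 < K" "\<And>f. f \<in> H \<Longrightarrow> nrm (T f) \<le> K * nrm f"
    using bounded_operator_bound[OF T(1)] by blast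
  obtain c where c: "0 < c" "\<And>f. f \<in> H \<Longrightarrow> c * nrm f \<le> nrm (T f)"
    using T(3) by (auto simp: bounded_below_def)
  \<comment> \<open>With this scaling \<open>\<alpha>\<close> times the square of \<open>T\<close>
    is at most \<open>1\<close>, so \<open>R\<close> is positive.\<close>
  define \<alpha> where "\<alpha> = 1 / K\<^sup>2"
  have \<alpha>: "0 < \<alpha>" "\<alpha> * K\<^sup>2 = 1" using K(1) by (auto simp: \<alpha>_def)
  define R where "R f = (\<lambda>v. f v - \<alpha> * T (T f) v)" for f
  \<comment> \<open>If \<open>H\<close> has no nonzero vector, \<open>c\<close> may exceed
    \<open>K\<close>; the minimum keeps \<open>q\<close> nonnegative in that case too.\<close>
  define q where "q = 1 - \<alpha> * min c K ^ 2"
  have q: "0 \<le> q" "q < 1"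
    using K(1) c(1) by (auto simp: q_def \<alpha>_def power_mono field_simps)
  have R_mem: "R f \<in> H" if "f \<in> H" for f
    using that by (auto simp: R_def op_mem[OF T(1)] intro!: mem_intros)
  have R_add: "R (\<lambda>v. f v + g v) = (\<lambda>v. R f v + R g v)" if "f \<in> H" "g \<in> H" for f g
    using that by (simp add: R_def op_add[OF T(1)] op_mem[OF T(1)] algebra_simps)
  have R_scale: "R (\<lambda>v. c * f v) = (\<lambda>v. c * R f v)" if "f \<in> H" for c f
    using that by (simp add: R_def op_scale[OF T(1)] op_mem[OF T(1)] algebra_simps)
  have ip_R: "ip (R f) f = (nrm f)\<^sup>2 - \<alpha> * (nrm (T f))\<^sup>2" if f: "f \<in> H" for f
    using T(2) f by (simp add: R_def ip_simps op_mem[OF T(1)] nrm_square self_adjoint_def)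
  have pos: "0 \<le> ip (R f) f" if f: "f \<in> H" for f
  proof -
    have "(nrm (T f))\<^sup>2 \<le> (K * nrm f)\<^sup>2"
      using K(2)[OF f] f by (intro power_mono nrm_nonneg op_mem[OF T(1)])
    then have "\<alpha> * (nrm (T f))\<^sup>2 \<le> \<alpha> * K\<^sup>2 * (nrm f)\<^sup>2"
      using \<alpha>(1) by (simp add: power_mult_distrib)
    then show ?thesis using \<alpha>(2) ip_R[OF f] by simp
  qed
  have le: "ip (R f) f \<le> q * ip f f" if f: "f \<in> H" for f
  proof -
    have "min c K * nrm f \<le> nrm (T f)"
      using c(2)[OF f] mult_right_mono[OF min.cobounded1 nrm_nonneg[OF f], of c K] by linarith
    then have "(min c K * nrm f)\<^sup>2 \<le> (nrm (T f))\<^sup>2"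
      using c(1) K(1) nrm_nonneg[OF f] by (intro power_mono) auto
    then have "\<alpha> * (min c K ^ 2 * (nrm f)\<^sup>2) \<le> \<alpha> * (nrm (T f))\<^sup>2"
      using \<alpha>(1) by (simp add: power_mult_distrib)
    then show ?thesis
      using ip_R[OF f] by (simp add: q_def algebra_simps flip: nrm_square[OF f])
  qed
  have sym: "self_adjoint R"
    unfolding self_adjoint_def R_def
  proof (intro ballI)
    fix f g assume fg: "f \<in> H" "g \<in> H"
    show "ip (\<lambda>v. f v - \<alpha> * T (T f) v) g = ip f (\<lambda>v. g v - \<alpha> * T (T g) v)"
      using T(2) fg by (simp only: ip_simps op_mem[OF T(1)] self_adjoint_def)
  qed
  \<comment> \<open>From \<open>0 \<le> R \<le> q\<close> as quadratic forms:
    \<open>positive_operator_bound\<close> gives one factor \<open>q\<close> and the bound on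
    \<open>ip (R f) f\<close> the other.\<close>
  have R_contr: "nrm (R f) \<le> q * nrm f" if f: "f \<in> H" for f
  proof (rule power2_le_imp_le)
    have "ip (R f) (R f) \<le> q * ip (R f) f"
      by (rule positive_operator_bound) (fact R_mem R_add R_scale sym pos le f)+
    then have "(nrm (R f))\<^sup>2 \<le> q * ip (R f) f"
      by (simp add: nrm_square R_mem f)
    also have "\<dots> \<le> q * (q * ip f f)"
      by (intro mult_left_mono le q f)
    finally show "(nrm (R f))\<^sup>2 \<le> (q * nrm f)\<^sup>2"
      using f by (simp add: nrm_square power_mult_distrib power2_eq_square[of q])
  qed (use q f in \<open>simp add: nrm_nonneg\<close>)
  define \<Phi> where "\<Phi> f = (\<lambda>v. R f v + \<alpha> * g v)" for f
  have \<Phi>_mem: "\<Phi> f \<in> H" if "f \<in> H" for f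
    unfolding \<Phi>_def using that g by (intro mem_intros R_mem)
  interpret Metric_space H distance by (rule Metric_space_distance)
  obtain f where f: "f \<in> H" "\<Phi> f = f"
  proof (rule Banach_fixedpoint_thm[OF mcomplete_distance nonempty _ q(2), of \<Phi>])
    fix f h assume fh: "f \<in> H" "h \<in> H"
    have "(\<lambda>v. \<Phi> f v - \<Phi> h v) = R (\<lambda>v. f v - h v)"
      using R_add[OF fh(1) scale_mem[OF fh(2), of "-1"]] R_scale[OF fh(2), of "-1"]
      by (auto simp: \<Phi>_def)
    then show "distance (\<Phi> f) (\<Phi> h) \<le> q * distance f h"
      using R_contr[OF diff_mem[OF fh]] fh by (simp add: distance_def \<Phi>_mem)
  qed (use \<Phi>_mem in auto)
  have "T (T f) = g"
  proof
    fix v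
    have "\<alpha> * T (T f) v = \<alpha> * g v"
      using fun_cong[OF f(2), of v] by (auto simp: \<Phi>_def R_def)
    then show "T (T f) v = g v" using \<alpha>(1) by auto
  qed
  then show thesis using that[OF op_mem[OF T(1) f(1)]] by blast
qed

text \<open>The lower bound \<open>c\<close> gives injectivity and the bound \<open>1 / c\<close>
  for the inverse; surjectivity is \<open>bounded_below_imp_surj\<close>.\<close>

lemma bounded_below_imp_invertible:
  assumes T: "bounded_operator T" "self_adjoint T" "bounded_below T"
  shows "invertible_operator T"
proof -
  obtain c where c: "0 < c" "\<And>f. f \<in> H \<Longrightarrow> c * nrm f \<le> nrm (T f)"
    using T(3) by (auto simp: bounded_below_def)
  have inj: "inj_on T H"
  proof
    fix f g assume fg: "f \<in> H" "g \<in> H" "T f = T g"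
    have "c * nrm (\<lambda>v. f v - g v) \<le> 0"
      using c(2)[OF diff_mem[OF fg(1,2)]] fg by (simp add: op_diff[OF T(1)] nrm_zero)
    then have "nrm (\<lambda>v. f v - g v) = 0"
      using c(1) nrm_nonneg[OF diff_mem[OF fg(1,2)]] by (simp add: mult_le_0_iff)
    then show "f = g" using nrm_eq_0[OF diff_mem[OF fg(1,2)]] by (simp add: fun_eq_iff)
  qed
  define S where "S = inv_into H T"
  have surj: "\<exists>f\<in>H. T f = g" if "g \<in> H" for g
    using bounded_below_imp_surj[OF T that] by blast
  have TS: "T (S g) = g" and S_mem: "S g \<in> H" if "g \<in> H" for g
    using surj[OF that] by (auto simp: S_def f_inv_into_f inv_into_into)
  have ST: "S (T f) = f" if "f \<in> H" for f
    using inj that by (simp add: S_def)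
  have S_add: "S (\<lambda>v. f v + g v) = (\<lambda>v. S f v + S g v)" if "f \<in> H" "g \<in> H" for f g
    using ST[of "\<lambda>v. S f v + S g v"] that by (simp add: op_add[OF T(1)] S_mem TS add_mem)
  have S_scale: "S (\<lambda>v. a * f v) = (\<lambda>v. a * S f v)" if "f \<in> H" for a f
    using ST[of "\<lambda>v. a * S f v"] that by (simp add: op_scale[OF T(1)] S_mem TS scale_mem)
  have "nrm (S f) \<le> 1 / c * nrm f" if "f \<in> H" for f
    using c(2)[OF S_mem[OF that]] c(1) TS[OF that] by (simp add: field_simps)
  then have "bounded_operator S"
    unfolding bounded_operator_def using S_mem S_add S_scale by blast
  then show ?thesis unfolding invertible_operator_def using ST TS by blast
qed

text \<open>A shift without bounded inverse is not bounded below, in particular not by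
  \<open>\<epsilon>\<close>. The strict inequality itself rules out
  \<open>nrm f = 0\<close>.\<close>

lemma spectrum_approximate_eigenvector:
  assumes T: "bounded_operator T" "self_adjoint T" and x: "x \<in> spectrum T" and "0 < \<epsilon>"
  obtains f where "f \<in> H" "nrm f \<noteq> 0" "nrm (shift T x f) < \<epsilon> * nrm f"
proof -
  have "\<not> bounded_below (shift T x)"
    using bounded_below_imp_invertible[OF bounded_operator_shift[OF T(1)] self_adjoint_shift[OF T]] x
    by (auto simp: spectrum_def)
  then obtain f where f: "f \<in> H" "nrm (shift T x f) < \<epsilon> * nrm f"
    using \<open>0 < \<epsilon>\<close> by (auto simp: bounded_below_def not_le)
  moreover have "nrm f \<noteq> 0"
    using f nrm_nonneg[OF op_mem[OF bounded_operator_shift[OF T(1)] f(1)], of x] by auto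
  ultimately show thesis using that by blast
qed

end

section \<open>Weighted square-summable functions\<close>

lemma summable_on_dominated:
  fixes h b :: "'a \<Rightarrow> real"
  assumes "b summable_on S" "\<And>v. v \<in> S \<Longrightarrow> \<bar>h v\<bar> \<le> b v"
  shows "h summable_on S"
  by (rule abs_summable_summable, rule summable_on_comparison_test[OF assms(1)])
    (use assms(2) in auto)

lemma abs_mult_le_sum_squares: "\<bar>x * y\<bar> \<le> x\<^sup>2 + (y :: real)\<^sup>2"
proof -
  have "2 * (\<bar>x\<bar> * \<bar>y\<bar>) \<le> x\<^sup>2 + y\<^sup>2"
    using sum_squares_bound[of "\<bar>x\<bar>" "\<bar>y\<bar>"] by (simp add: mult.assoc)
  moreover have "0 \<le> \<bar>x\<bar> * \<bar>y\<bar>" by simp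
  ultimately show ?thesis unfolding abs_mult by linarith
qed

text \<open>For \<open>\<mu> = vertex_weight V E m\<close> this is \<open>L2 V E m\<close>. The
  weight is left general because a single row \<open>k v\<close> of a kernel also serves as a
  weight.\<close>

definition wl2 :: "'a set \<Rightarrow> ('a \<Rightarrow> real) \<Rightarrow> ('a \<Rightarrow> real) set" where
  "wl2 V \<mu> = {f. (\<forall>v. v \<notin> V \<longrightarrow> f v = 0) \<and> (\<lambda>v. \<mu> v * (f v)\<^sup>2) summable_on V}"

definition wip :: "'a set \<Rightarrow> ('a \<Rightarrow> real) \<Rightarrow> ('a \<Rightarrow> real) \<Rightarrow> ('a \<Rightarrow> real) \<Rightarrow> real" where
  "wip V \<mu> f g = (\<Sum>\<^sub>\<infinity>v\<in>V. \<mu> v * f v * g v)"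

lemma wip_self: "wip V \<mu> f f = (\<Sum>\<^sub>\<infinity>v\<in>V. \<mu> v * (f v)\<^sup>2)"
  by (simp add: wip_def power2_eq_square mult.assoc)

lemma wl2_mult_summable:
  assumes \<mu>: "\<And>v. v \<in> V \<Longrightarrow> 0 \<le> \<mu> v" and f: "f \<in> wl2 V \<mu>" and g: "g \<in> wl2 V \<mu>"
  shows "(\<lambda>v. \<mu> v * f v * g v) summable_on V"
proof (rule summable_on_dominated)
  show "(\<lambda>v. \<mu> v * (f v)\<^sup>2 + \<mu> v * (g v)\<^sup>2) summable_on V"
    using f g by (intro summable_on_add) (auto simp: wl2_def)
  show "\<bar>\<mu> v * f v * g v\<bar> \<le> \<mu> v * (f v)\<^sup>2 + \<mu> v * (g v)\<^sup>2" if "v \<in> V" for v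
    using mult_left_mono[OF abs_mult_le_sum_squares \<mu>[OF that], of "f v" "g v"] \<mu>[OF that]
    by (simp add: abs_mult mult.assoc distrib_left)
qed

lemma semi_inner_space_wl2:
  assumes \<mu>: "\<And>v. v \<in> V \<Longrightarrow> 0 \<le> \<mu> v"
  shows "semi_inner_space (wl2 V \<mu>) (wip V \<mu>)"
proof
  have summ: "(\<lambda>v. \<mu> v * f v * g v) summable_on V" if "f \<in> wl2 V \<mu>" "g \<in> wl2 V \<mu>" for f g
    using \<mu> that by (rule wl2_mult_summable)
  show "(\<lambda>v. c * f v) \<in> wl2 V \<mu>" if "f \<in> wl2 V \<mu>" for f c
    using that summable_on_cmult_right[of "\<lambda>v. \<mu> v * (f v)\<^sup>2" V "c\<^sup>2"]
    by (auto simp: wl2_def power_mult_distrib mult.left_commute)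
  show "wip V \<mu> (\<lambda>v. c * f v) g = c * wip V \<mu> f g" for c f g
    by (simp add: wip_def mult.assoc mult.left_commute[of _ c] infsum_cmult_right')
  show "wip V \<mu> f g = wip V \<mu> g f" for f g
    by (simp add: wip_def mult_ac)
  show "0 \<le> wip V \<mu> f f" for f
    unfolding wip_self by (intro infsum_nonneg mult_nonneg_nonneg \<mu>) auto
  fix f g assume fg: "f \<in> wl2 V \<mu>" "g \<in> wl2 V \<mu>"
  have "(\<lambda>v. \<mu> v * (f v)\<^sup>2 + 2 * (\<mu> v * f v * g v) + \<mu> v * (g v)\<^sup>2) summable_on V"
    using fg summ[OF fg] by (intro summable_on_add summable_on_cmult_right) (auto simp: wl2_def)
  then have "(\<lambda>v. \<mu> v * (f v + g v)\<^sup>2) summable_on V"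
    by (simp add: power2_sum algebra_simps)
  then show "(\<lambda>v. f v + g v) \<in> wl2 V \<mu>"
    using fg by (auto simp: wl2_def)
  show "wip V \<mu> (\<lambda>v. f v + g v) h = wip V \<mu> f h + wip V \<mu> g h" if h: "h \<in> wl2 V \<mu>" for h
    unfolding wip_def infsum_add[OF summ[OF fg(1) h] summ[OF fg(2) h], symmetric]
    by (simp add: algebra_simps)
qed

text \<open>Positivity of \<open>\<mu> v\<close> makes evaluation at \<open>v\<close> continuous, so
  a Cauchy sequence has a pointwise limit; finite partial sums then show that the limit is also one
  in norm.\<close>

lemma function_hilbert_space_wl2:
  assumes pos: "\<And>v. v \<in> V \<Longrightarrow> 0 < \<mu> v"
  shows "function_hilbert_space (wl2 V \<mu>) (wip V \<mu>)"
proof -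
  have \<mu>: "0 \<le> \<mu> v" if "v \<in> V" for v using pos[OF that] by simp
  interpret semi_inner_space "wl2 V \<mu>" "wip V \<mu>"
    by (rule semi_inner_space_wl2[OF \<mu>])
  have partial_sum_le: "(\<Sum>v\<in>F. \<mu> v * (f v)\<^sup>2) \<le> (nrm f)\<^sup>2"
    if "f \<in> wl2 V \<mu>" "finite F" "F \<subseteq> V" for f F
    unfolding nrm_square[OF that(1)] wip_self using that \<mu>
    by (intro finite_sum_le_infsum) (auto simp: wl2_def)
  show ?thesis
  proof
    have "(\<lambda>v. 0) \<in> wl2 V \<mu>" by (simp add: wl2_def)
    then show "wl2 V \<mu> \<noteq> {}" by blast
    fix f assume f: "f \<in> wl2 V \<mu>" "wip V \<mu> f f = 0"
    show "f = (\<lambda>v. 0)"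
    proof
      fix v
      show "f v = 0"
      proof (cases "v \<in> V")
        case True
        then have "\<mu> v * (f v)\<^sup>2 \<le> 0"
          using partial_sum_le[OF f(1), of "{v}"] f by (simp add: nrm_square)
        then show ?thesis using pos[OF True] by (simp add: mult_le_0_iff)
      qed (use f in \<open>simp add: wl2_def\<close>)
    qed
  next
    fix X :: "nat \<Rightarrow> 'a \<Rightarrow> real"
    assume X: "range X \<subseteq> wl2 V \<mu>"
      and Cauchy: "\<forall>\<epsilon>>0. \<exists>M. \<forall>j k. M \<le> j \<longrightarrow> M \<le> k \<longrightarrow> nrm (\<lambda>v. X j v - X k v) < \<epsilon>"
    have diff: "(\<lambda>v. X j v - X k v) \<in> wl2 V \<mu>" for j k
      using X by (intro diff_mem) auto
    have conv: "convergent (\<lambda>n. X n v)" if v: "v \<in> V" for v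
    proof (rule Cauchy_convergent, rule metric_CauchyI)
      fix e :: real assume "0 < e"
      then have e': "0 < e * sqrt (\<mu> v)" using pos[OF v] by simp
      then obtain M where M: "\<And>j k. M \<le> j \<Longrightarrow> M \<le> k \<Longrightarrow> nrm (\<lambda>v. X j v - X k v) < e * sqrt (\<mu> v)"
        using Cauchy by blast
      have "dist (X j v) (X k v) < e" if jk: "M \<le> j" "M \<le> k" for j k
      proof -
        have "\<mu> v * (X j v - X k v)\<^sup>2 \<le> (nrm (\<lambda>v. X j v - X k v))\<^sup>2"
          using partial_sum_le[OF diff, of "{v}"] v by simp
        also have "\<dots> < (e * sqrt (\<mu> v))\<^sup>2"
          using M[OF jk] nrm_nonneg[OF diff] by (intro power_strict_mono) auto
        finally have "(X j v - X k v)\<^sup>2 < e\<^sup>2"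
          using pos[OF v] by (simp add: power_mult_distrib mult.commute)
        then show ?thesis
          using \<open>0 < e\<close> power2_less_imp_less[of "\<bar>X j v - X k v\<bar>" e] by (simp add: dist_real_def)
      qed
      then show "\<exists>M. \<forall>j\<ge>M. \<forall>k\<ge>M. dist (X j v) (X k v) < e" by blast
    qed
    define f where "f v = (if v \<in> V then lim (\<lambda>n. X n v) else 0)" for v
    have lim: "(\<lambda>n. X n v) \<longlonglongrightarrow> f v" if "v \<in> V" for v
      using conv[OF that] that by (simp add: f_def convergent_LIMSEQ_iff)
    have tail: "\<exists>M. \<forall>j\<ge>M. (\<lambda>v. X j v - f v) \<in> wl2 V \<mu> \<and> nrm (\<lambda>v. X j v - f v) \<le> \<epsilon>" if "0 < \<epsilon>" for \<epsilon>
    proof -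
      obtain M where M: "\<And>j k. M \<le> j \<Longrightarrow> M \<le> k \<Longrightarrow> nrm (\<lambda>v. X j v - X k v) < \<epsilon>"
        using Cauchy \<open>0 < \<epsilon>\<close> by blast
      have "(\<lambda>v. X j v - f v) \<in> wl2 V \<mu> \<and> nrm (\<lambda>v. X j v - f v) \<le> \<epsilon>" if j: "M \<le> j" for j
      proof -
        \<comment> \<open>Only a finite sum is taken to the limit in \<open>k\<close>. As the bound
          is uniform in \<open>F\<close>, it gives both summability and the estimate of the
          norm.\<close>
        have bound: "(\<Sum>v\<in>F. \<mu> v * (X j v - f v)\<^sup>2) \<le> \<epsilon>\<^sup>2" if F: "finite F" "F \<subseteq> V" for F
        proof (rule LIMSEQ_le_const2)
          show "(\<lambda>k. \<Sum>v\<in>F. \<mu> v * (X j v - X k v)\<^sup>2) \<longlonglongrightarrow> (\<Sum>v\<in>F. \<mu> v * (X j v - f v)\<^sup>2)"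
            using F lim by (intro tendsto_intros) auto
          have "(\<Sum>v\<in>F. \<mu> v * (X j v - X k v)\<^sup>2) \<le> \<epsilon>\<^sup>2" if "M \<le> k" for k
            using partial_sum_le[OF diff F, of j k]
              power_mono[OF less_imp_le[OF M[OF j that]] nrm_nonneg[OF diff], of 2] by linarith
          then show "\<exists>N. \<forall>k\<ge>N. (\<Sum>v\<in>F. \<mu> v * (X j v - X k v)\<^sup>2) \<le> \<epsilon>\<^sup>2" by blast
        qed
        have summ: "(\<lambda>v. \<mu> v * (X j v - f v)\<^sup>2) summable_on V"
          using bound \<mu> by (intro nonneg_bdd_above_summable_on bdd_aboveI2[where M = "\<epsilon>\<^sup>2"]) auto
        moreover have "X j v = 0" if "v \<notin> V" for v
          using X that by (auto simp: wl2_def image_subset_iff)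
        ultimately have mem: "(\<lambda>v. X j v - f v) \<in> wl2 V \<mu>"
          by (auto simp: wl2_def f_def)
        have "(nrm (\<lambda>v. X j v - f v))\<^sup>2 \<le> \<epsilon>\<^sup>2"
          unfolding nrm_square[OF mem] wip_self by (rule infsum_le_finite_sums[OF summ bound])
        then show ?thesis
          using mem \<open>0 < \<epsilon>\<close> by (auto intro: power2_le_imp_le)
      qed
      then show ?thesis by blast
    qed
    \<comment> \<open>Membership of the limit \<open>f\<close> is recovered from
      \<open>f = X j - (X j - f)\<close>.\<close>
    obtain j where "(\<lambda>v. X j v - f v) \<in> wl2 V \<mu>" using tail[of 1] by auto
    moreover have "X j \<in> wl2 V \<mu>" using X by auto
    ultimately have "(\<lambda>v. X j v - (X j v - f v)) \<in> wl2 V \<mu>" by (rule diff_mem[rotated])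
    then have "f \<in> wl2 V \<mu>" by simp
    moreover have "(\<lambda>n. nrm (\<lambda>v. X n v - f v)) \<longlonglongrightarrow> 0"
    proof (rule LIMSEQ_I)
      fix r :: real assume "0 < r"
      then obtain M where "\<And>j. M \<le> j \<Longrightarrow> (\<lambda>v. X j v - f v) \<in> wl2 V \<mu> \<and> nrm (\<lambda>v. X j v - f v) \<le> r / 2"
        using tail[of "r / 2"] by auto
      then have "norm (nrm (\<lambda>v. X j v - f v) - 0) < r" if "M \<le> j" for j
        using that nrm_nonneg[of "\<lambda>v. X j v - f v"] \<open>0 < r\<close> by fastforce
      then show "\<exists>M. \<forall>j\<ge>M. norm (nrm (\<lambda>v. X j v - f v) - 0) < r" by blast
    qed
    ultimately show "\<exists>f\<in>wl2 V \<mu>. (\<lambda>n. nrm (\<lambda>v. X n v - f v)) \<longlonglongrightarrow> 0" by blast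
  qed
qed

section \<open>Schur's test for symmetric kernels\<close>

locale schur_kernel =
  fixes V :: "'a set" and \<mu> :: "'a \<Rightarrow> real" and k :: "'a \<Rightarrow> 'a \<Rightarrow> real" and q :: real
  assumes \<mu>_pos: "v \<in> V \<Longrightarrow> 0 < \<mu> v"
    and k_nonneg: "v \<in> V \<Longrightarrow> u \<in> V \<Longrightarrow> 0 \<le> k v u"
    and k_sym: "v \<in> V \<Longrightarrow> u \<in> V \<Longrightarrow> k v u = k u v"
    and k_summable: "v \<in> V \<Longrightarrow> k v summable_on V"
    and row_sum_le: "v \<in> V \<Longrightarrow> (\<Sum>\<^sub>\<infinity>u\<in>V. k v u) \<le> q * \<mu> v"
    and q_nonneg: "0 \<le> q"
begin

sublocale function_hilbert_space "wl2 V \<mu>" "wip V \<mu>"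
  by (rule function_hilbert_space_wl2[OF \<mu>_pos])

text \<open>The operator has entries \<open>k v u / \<mu> v\<close>. Symmetry is asked of
  \<open>k\<close>, not of these entries, and amounts to self-adjointness for the weight
  \<open>\<mu>\<close>.\<close>

definition kernel_op :: "('a \<Rightarrow> real) \<Rightarrow> ('a \<Rightarrow> real)" where
  "kernel_op f = (\<lambda>v. if v \<in> V then (\<Sum>\<^sub>\<infinity>u\<in>V. k v u * f u) / \<mu> v else 0)"

text \<open>By symmetry the entry also lies in row \<open>u\<close>, whose sum bounds it. Hence each
  row weight \<open>k v\<close> is dominated by \<open>q * \<mu>\<close>.\<close>

lemma kernel_le: "v \<in> V \<Longrightarrow> u \<in> V \<Longrightarrow> k v u \<le> q * \<mu> u"
  using finite_sum_le_infsum[OF k_summable, of u "{v}"] row_sum_le[of u] k_nonneg[of u] k_sym[of u v]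
  by force

lemma wl2_row:
  assumes f: "f \<in> wl2 V \<mu>" and v: "v \<in> V"
  shows "f \<in> wl2 V (k v)"
proof -
  have "(\<lambda>u. q * (\<mu> u * (f u)\<^sup>2)) summable_on V"
    using f by (intro summable_on_cmult_right) (simp add: wl2_def)
  then have "(\<lambda>u. k v u * (f u)\<^sup>2) summable_on V"
    by (rule summable_on_comparison_test)
      (use v k_nonneg in \<open>auto simp: mult.assoc[symmetric] intro!: mult_right_mono kernel_le\<close>)
  then show ?thesis using f by (simp add: wl2_def)
qed

text \<open>The constant \<open>1\<close> on \<open>V\<close>: pairing with it in the weight
  \<open>k v\<close> produces row sums, so it is the second vector in
  \<open>row_Cauchy_Schwarz\<close>.\<close>

lemma indicator_row: "v \<in> V \<Longrightarrow> indicator V \<in> wl2 V (k v)"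
  using k_summable[of v] summable_on_cong[of V "\<lambda>u. k v u * (indicator V u)\<^sup>2" "k v"]
  by (auto simp: wl2_def)

lemma row_mult_summable:
  assumes "f \<in> wl2 V \<mu>" "v \<in> V"
  shows "(\<lambda>u. k v u * f u) summable_on V"
  using wl2_mult_summable[OF k_nonneg[OF assms(2)] wl2_row[OF assms] indicator_row[OF assms(2)]]
  by (rule iffD1[OF summable_on_cong, rotated]) auto

lemma row_Cauchy_Schwarz:
  assumes "f \<in> wl2 V \<mu>" "v \<in> V"
  shows "(\<Sum>\<^sub>\<infinity>u\<in>V. k v u * f u)\<^sup>2 \<le> q * \<mu> v * (\<Sum>\<^sub>\<infinity>u\<in>V. k v u * (f u)\<^sup>2)"
proof -
  interpret row: semi_inner_space "wl2 V (k v)" "wip V (k v)"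
    by (rule semi_inner_space_wl2[OF k_nonneg[OF assms(2)]])
  have eq: "wip V (k v) f (indicator V) = (\<Sum>\<^sub>\<infinity>u\<in>V. k v u * f u)"
    "wip V (k v) (indicator V) (indicator V) = (\<Sum>\<^sub>\<infinity>u\<in>V. k v u)"
    by (auto simp: wip_def intro!: infsum_cong)
  have "(\<Sum>\<^sub>\<infinity>u\<in>V. k v u * f u)\<^sup>2 \<le> wip V (k v) f f * (\<Sum>\<^sub>\<infinity>u\<in>V. k v u)"
    using row.Cauchy_Schwarz[OF wl2_row[OF assms] indicator_row[OF assms(2)]] by (simp add: eq)
  also have "\<dots> \<le> wip V (k v) f f * (q * \<mu> v)"
    by (intro mult_left_mono row_sum_le row.ip_nonneg wl2_row assms)
  finally show ?thesis by (simp add: wip_self mult.commute)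
qed

text \<open>Summing over \<open>u\<close> first turns the first family into row sums times
  \<open>(f v)^2\<close>; the second follows by swapping coordinates. Both license the interchanges
  of summation below.\<close>

lemma double_summable:
  assumes f: "f \<in> wl2 V \<mu>"
  shows "(\<lambda>(v, u). k v u * (f v)\<^sup>2) summable_on V \<times> V"
    and "(\<lambda>(v, u). k v u * (f u)\<^sup>2) summable_on V \<times> V"
proof -
  have "(\<lambda>v. q * (\<mu> v * (f v)\<^sup>2)) summable_on V"
    using f by (intro summable_on_cmult_right) (simp add: wl2_def)
  then have "(\<lambda>v. (\<Sum>\<^sub>\<infinity>u\<in>V. k v u) * (f v)\<^sup>2) summable_on V"
    by (rule summable_on_comparison_test)
      (auto simp: mult.assoc[symmetric] intro!: mult_right_mono row_sum_le mult_nonneg_nonneg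
        infsum_nonneg k_nonneg)
  then show *: "(\<lambda>(v, u). k v u * (f v)\<^sup>2) summable_on V \<times> V"
    by (rule summable_on_SigmaI[rotated])
      (auto intro!: has_sum_cmult_left has_sum_infsum k_summable mult_nonneg_nonneg k_nonneg)
  show "(\<lambda>(v, u). k v u * (f u)\<^sup>2) summable_on V \<times> V"
    using iffD1[OF summable_on_swap *]
    by (rule iffD1[OF summable_on_cong, rotated]) (auto simp: k_sym)
qed

text \<open>Schur's test: Cauchy-Schwarz in each row gives one factor \<open>q\<close>; after
  interchanging the sums, column sums equal row sums by symmetry and give the second.\<close>

lemma kernel_op_bound:
  assumes f: "f \<in> wl2 V \<mu>"
  shows "kernel_op f \<in> wl2 V \<mu>" and "nrm (kernel_op f) \<le> q * nrm f"
proof -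
  define G where "G v = (\<Sum>\<^sub>\<infinity>u\<in>V. k v u * (f u)\<^sup>2)" for v
  have G: "G summable_on V"
    using summable_on_Sigma_banach[OF double_summable(2)[OF f]] by (simp add: G_def[abs_def])
  have le: "\<mu> v * (kernel_op f v)\<^sup>2 \<le> q * G v" if v: "v \<in> V" for v
  proof -
    have "\<mu> v * (kernel_op f v)\<^sup>2 = (\<Sum>\<^sub>\<infinity>u\<in>V. k v u * f u)\<^sup>2 / \<mu> v"
      using \<mu>_pos[OF v] v by (simp add: kernel_op_def power_divide power2_eq_square)
    also have "\<dots> \<le> q * \<mu> v * G v / \<mu> v"
      unfolding G_def using \<mu>_pos[OF v] by (intro divide_right_mono row_Cauchy_Schwarz f v) auto
    also have "\<dots> = q * G v" using \<mu>_pos[OF v] by simp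
    finally show ?thesis .
  qed
  have summ: "(\<lambda>v. \<mu> v * (kernel_op f v)\<^sup>2) summable_on V"
  proof (rule summable_on_comparison_test[OF summable_on_cmult_right[OF G] le])
    show "0 \<le> \<mu> v * (kernel_op f v)\<^sup>2" if "v \<in> V" for v
      using \<mu>_pos[OF that] by simp
  qed
  then show mem: "kernel_op f \<in> wl2 V \<mu>"
    by (simp add: wl2_def kernel_op_def)
  have "(nrm (kernel_op f))\<^sup>2 \<le> (\<Sum>\<^sub>\<infinity>v\<in>V. q * G v)"
    unfolding nrm_square[OF mem] wip_self
    by (rule infsum_mono[OF summ summable_on_cmult_right[OF G] le])
  also have "\<dots> = q * (\<Sum>\<^sub>\<infinity>v\<in>V. G v)" by (rule infsum_cmult_right')
  also have "(\<Sum>\<^sub>\<infinity>v\<in>V. G v) = (\<Sum>\<^sub>\<infinity>u\<in>V. \<Sum>\<^sub>\<infinity>v\<in>V. k v u * (f u)\<^sup>2)"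
    unfolding G_def by (rule infsum_swap_banach[OF double_summable(2)[OF f]])
  also have "\<dots> = (\<Sum>\<^sub>\<infinity>u\<in>V. (\<Sum>\<^sub>\<infinity>v\<in>V. k u v) * (f u)\<^sup>2)"
    unfolding infsum_cmult_left'[symmetric] by (intro infsum_cong) (simp add: k_sym)
  also have "\<dots> \<le> (\<Sum>\<^sub>\<infinity>u\<in>V. q * (\<mu> u * (f u)\<^sup>2))"
  proof (rule infsum_mono)
    show "(\<lambda>v. q * (\<mu> v * (f v)\<^sup>2)) summable_on V"
      using f by (intro summable_on_cmult_right) (simp add: wl2_def)
    then show "(\<lambda>u. (\<Sum>\<^sub>\<infinity>v\<in>V. k u v) * (f u)\<^sup>2) summable_on V"
      by (rule summable_on_comparison_test)
        (auto simp: mult.assoc[symmetric] intro!: mult_right_mono row_sum_le mult_nonneg_nonneg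
          infsum_nonneg k_nonneg)
    show "(\<Sum>\<^sub>\<infinity>v\<in>V. k u v) * (f u)\<^sup>2 \<le> q * (\<mu> u * (f u)\<^sup>2)" if "u \<in> V" for u
      using mult_right_mono[OF row_sum_le[OF that], of "(f u)\<^sup>2"] by (simp add: mult.assoc)
  qed
  also have "\<dots> = q * (nrm f)\<^sup>2"
    by (simp add: infsum_cmult_right' nrm_square f wip_self)
  finally have "(nrm (kernel_op f))\<^sup>2 \<le> (q * nrm f)\<^sup>2"
    using q_nonneg by (simp add: power_mult_distrib power2_eq_square[of q] mult_left_mono mult.assoc)
  then show "nrm (kernel_op f) \<le> q * nrm f"
    by (rule power2_le_imp_le) (simp add: q_nonneg nrm_nonneg f)
qed

lemma bounded_operator_kernel_op: "bounded_operator kernel_op"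
  unfolding bounded_operator_def
proof (intro conjI ballI allI)
  show "\<exists>K. \<forall>f\<in>wl2 V \<mu>. nrm (kernel_op f) \<le> K * nrm f"
    using kernel_op_bound(2) by blast
  show "kernel_op f \<in> wl2 V \<mu>" if "f \<in> wl2 V \<mu>" for f by (rule kernel_op_bound(1)[OF that])
  show "kernel_op (\<lambda>v. f v + g v) = (\<lambda>v. kernel_op f v + kernel_op g v)"
    if "f \<in> wl2 V \<mu>" "g \<in> wl2 V \<mu>" for f g
    using that
    by (auto simp: kernel_op_def fun_eq_iff distrib_left infsum_add row_mult_summable add_divide_distrib)
  show "kernel_op (\<lambda>v. c * f v) = (\<lambda>v. c * kernel_op f v)" for c f
    by (auto simp: kernel_op_def fun_eq_iff mult.left_commute[of _ c] infsum_cmult_right')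
qed

text \<open>Both sides are the double sum of \<open>k v u * f u * g v\<close> in different orders;
  the majorant \<open>k v u * ((f u)^2 + (g v)^2)\<close> permits the interchange.\<close>

lemma self_adjoint_kernel_op: "self_adjoint kernel_op"
  unfolding self_adjoint_def
proof (intro ballI)
  fix f g assume f: "f \<in> wl2 V \<mu>" and g: "g \<in> wl2 V \<mu>"
  \<comment> \<open>The weight \<open>\<mu> v\<close> cancels the denominator in
    \<open>kernel_op\<close>.\<close>
  have left: "wip V \<mu> (kernel_op h) l = (\<Sum>\<^sub>\<infinity>v\<in>V. \<Sum>\<^sub>\<infinity>u\<in>V. k v u * h u * l v)" for h l
    unfolding wip_def infsum_cmult_left'
    using \<mu>_pos by (intro infsum_cong) (force simp: kernel_op_def)
  have "(\<lambda>(v, u). k v u * (f u)\<^sup>2 + k v u * (g v)\<^sup>2) summable_on V \<times> V"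
    using summable_on_add[OF double_summable(2)[OF f] double_summable(1)[OF g]]
    by (simp add: case_prod_unfold)
  then have "(\<lambda>(v, u). k v u * f u * g v) summable_on V \<times> V"
  proof (rule summable_on_dominated, clarify)
    fix v u assume vu: "v \<in> V" "u \<in> V"
    show "\<bar>k v u * f u * g v\<bar> \<le> k v u * (f u)\<^sup>2 + k v u * (g v)\<^sup>2"
      using mult_left_mono[OF abs_mult_le_sum_squares k_nonneg[OF vu], of "f u" "g v"] k_nonneg[OF vu]
      by (simp add: abs_mult mult.assoc distrib_left)
  qed
  then have "wip V \<mu> (kernel_op f) g = (\<Sum>\<^sub>\<infinity>u\<in>V. \<Sum>\<^sub>\<infinity>v\<in>V. k v u * f u * g v)"
    unfolding left by (rule infsum_swap_banach)
  also have "\<dots> = wip V \<mu> (kernel_op g) f"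
    unfolding left by (intro infsum_cong) (simp add: k_sym mult_ac)
  also have "\<dots> = wip V \<mu> f (kernel_op g)"
    by (rule ip_sym[OF kernel_op_bound(1)[OF g] f])
  finally show "wip V \<mu> (kernel_op f) g = wip V \<mu> f (kernel_op g)" .
qed

end

section \<open>The normalised Laplacian\<close>

lemma infdist_reflection_image: "infdist x (reflection ` X) = infdist (reflection x) X"
proof -
  have "dist x (reflection a) = dist (reflection x) a" for a
    by (simp add: reflection_def dist_real_def abs_minus_commute algebra_simps)
  then show ?thesis by (simp add: infdist_def image_image)
qed

text \<open>Since the reflection is an isometric involution, both one-sided suprema range over the
  same numbers \<open>infdist (reflection x) X\<close>.\<close>

lemma hausdorff_distance_reflection_le:
  assumes "X \<noteq> {}" "\<And>x. x \<in> X \<Longrightarrow> infdist (reflection x) X \<le> c"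
  shows "hausdorff_distance X (reflection ` X) \<le> c"
  using assms unfolding hausdorff_distance_def infdist_reflection_image image_image
  by (intro max.boundedI cSUP_least) auto

section \<open>The averaging operator and the Laplacian of a graph\<close>

locale summable_graph =
  fixes V :: "'a set" and E :: "'a set set" and m :: "'a set \<Rightarrow> real"
  assumes graph: "summable_weighted_graph V E m" and no_isolated: "no_isolated_vertices V E"
begin

abbreviation "w \<equiv> edge_weight E m"
abbreviation "\<mu> \<equiv> vertex_weight V E m"

lemma edge_weight_sym: "w v u = w u v"
  by (simp add: edge_weight_def insert_commute)

lemma edge_weight_nonneg: "0 \<le> w v u"
  using graph by (auto simp: edge_weight_def summable_weighted_graph_def weighted_graph_def less_imp_le)

text \<open>For fixed \<open>v\<close> the map from \<open>u\<close> to \<open>{v, u}\<close> is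
  injective, so the nonzero part of the row is a subfamily of the summable family
  \<open>m\<close>.\<close>

lemma edge_weight_summable: "w v summable_on V"
proof -
  let ?U = "{u \<in> V. {v, u} \<in> E}"
  have "m summable_on (\<lambda>u. {v, u}) ` ?U"
    using graph by (auto simp: summable_weighted_graph_def intro: summable_on_subset_banach)
  moreover have "inj_on (\<lambda>u. {v, u}) ?U"
    by (auto simp: inj_on_def doubleton_eq_iff)
  ultimately have "(\<lambda>u. m {v, u}) summable_on ?U"
    by (simp add: summable_on_reindex o_def)
  then show ?thesis
    by (rule iffD1[OF summable_on_cong_neutral, rotated -1]) (auto simp: edge_weight_def)
qed

lemma vertex_weight_pos:
  assumes "v \<in> V"
  shows "0 < \<mu> v"
proof -
  obtain u where u: "u \<in> V" "{v, u} \<in> E"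
    using no_isolated assms by (auto simp: no_isolated_vertices_def)
  then have "0 < w v u"
    using graph by (auto simp: edge_weight_def summable_weighted_graph_def weighted_graph_def)
  also have "\<dots> \<le> \<mu> v"
    using finite_sum_le_infsum[OF edge_weight_summable, of "{u}" v] u(1) edge_weight_nonneg
    by (simp add: vertex_weight_def)
  finally show ?thesis .
qed

text \<open>This is \<open>P\<close>, the transition operator of the random walk; its row sums are
  exactly \<open>\<mu> v\<close>, whence the constant \<open>1\<close>.\<close>

sublocale averaging: schur_kernel V \<mu> w 1
proof
  show "0 < \<mu> v" if "v \<in> V" for v by (rule vertex_weight_pos[OF that])
qed (simp_all add: edge_weight_nonneg edge_weight_summable vertex_weight_def edge_weight_sym)

text \<open>Membership in \<open>wl2 V \<mu>\<close> makes both sides vanish off \<open>V\<close>;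
  on \<open>V\<close> only the factor \<open>1 / \<mu> v\<close> moves out of the sum.\<close>

lemma laplacian_eq:
  assumes "f \<in> wl2 V \<mu>"
  shows "laplacian V E m f = (\<lambda>v. f v - averaging.kernel_op f v)"
proof
  fix v
  have "(\<Sum>\<^sub>\<infinity>u\<in>V. w v u / \<mu> v * f u) = (\<Sum>\<^sub>\<infinity>u\<in>V. 1 / \<mu> v * (w v u * f u))"
    by (intro infsum_cong) simp
  then show "laplacian V E m f v = f v - averaging.kernel_op f v"
    using assms unfolding infsum_cmult_right' by (simp add: laplacian_def averaging.kernel_op_def wl2_def)
qed

lemma bounded_operator_laplacian: "averaging.bounded_operator (laplacian V E m)"
  by (rule averaging.bounded_operator_id_minus[OF averaging.bounded_operator_kernel_op laplacian_eq])

lemma self_adjoint_laplacian: "averaging.self_adjoint (laplacian V E m)"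
  by (rule averaging.self_adjoint_id_minus[OF averaging.bounded_operator_kernel_op
        averaging.self_adjoint_kernel_op laplacian_eq])

text \<open>The operator notions of the locale copy the shape of the \<open>L2\<close> ones, so
  unfolding suffices.\<close>

lemma L2_spectrum_eq: "L2_spectrum V E m T = averaging.spectrum T"
proof -
  have "L2 V E m = wl2 V \<mu>" by (simp add: L2_def wl2_def)
  moreover have "L2_norm V E m = averaging.nrm"
    by (auto simp: L2_norm_def L2_inner_def averaging.nrm_def wip_def)
  ultimately show ?thesis
    unfolding L2_spectrum_def averaging.spectrum_def averaging.invertible_operator_def
      averaging.bounded_operator_def L2_bounded_operator_def averaging.shift_def by simp
qed

section \<open>Transitions inside the parts of a partition\<close>

lemma trans_prob_eq: "v \<in> V \<Longrightarrow> (\<Sum>\<^sub>\<infinity>u\<in>S. w v u) = trans_prob V E m S v * \<mu> v"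
  using vertex_weight_pos[of v] by (simp add: trans_prob_def)

text \<open>Supplies the upper bound by which the real-valued \<open>SUP\<close> in
  \<open>kappa_partition\<close> dominates its members.\<close>

lemma trans_prob_le_1:
  assumes "v \<in> V" "S \<subseteq> V"
  shows "trans_prob V E m S v \<le> 1"
proof -
  have "(\<Sum>\<^sub>\<infinity>u\<in>S. w v u) \<le> \<mu> v"
    unfolding vertex_weight_def using assms(2)
    by (intro infsum_mono_neutral summable_on_subset_banach[OF edge_weight_summable assms(2)]
        edge_weight_summable) (auto simp: edge_weight_nonneg)
  then show ?thesis using vertex_weight_pos[OF assms(1)] by (simp add: trans_prob_def)
qed

lemma trans_prob_le_kappa_partition:
  assumes AB: "A \<union> B = V" and v: "v \<in> V"
  shows "v \<in> A \<Longrightarrow> trans_prob V E m A v \<le> kappa_partition V E m A B"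
    and "v \<in> B \<Longrightarrow> trans_prob V E m B v \<le> kappa_partition V E m A B"
proof -
  have bdd: "bdd_above (trans_prob V E m S ` S)" if "S \<subseteq> V" for S
    using that by (intro bdd_aboveI2[where M = 1] trans_prob_le_1) auto
  have "trans_prob V E m S v \<le> (SUP u\<in>S. trans_prob V E m S u)" if "S \<subseteq> V" "v \<in> S" for S
    using that by (intro cSUP_upper bdd)
  from this[of A] this[of B]
  show "v \<in> A \<Longrightarrow> trans_prob V E m A v \<le> kappa_partition V E m A B"
    and "v \<in> B \<Longrightarrow> trans_prob V E m B v \<le> kappa_partition V E m A B"
    using AB by (auto simp: kappa_partition_def le_max_iff_disj)
qed

text \<open>The weights of \<open>P'\<close>. Naming \<open>A\<close> alone suffices: within
  \<open>V\<close>, lying outside \<open>A\<close> means lying in \<open>B\<close>.\<close>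

definition inner_weight :: "'a set \<Rightarrow> 'a \<Rightarrow> 'a \<Rightarrow> real" where
  "inner_weight A v u = (if v \<in> A \<longleftrightarrow> u \<in> A then w v u else 0)"

text \<open>The row sum at \<open>v\<close> is \<open>\<mu> v\<close> times the probability of
  staying in the part \<open>S\<close> that contains \<open>v\<close>, and
  \<open>kappa_partition\<close> bounds that probability.\<close>

lemma schur_kernel_inner_weight:
  assumes AB: "A \<union> B = V" "A \<inter> B = {}"
  shows "schur_kernel V \<mu> (inner_weight A) (kappa_partition V E m A B)"
proof
  fix v assume v: "v \<in> V"
  show "0 < \<mu> v" by (rule vertex_weight_pos[OF v])
  show "0 \<le> inner_weight A v u" "inner_weight A v u = inner_weight A u v" for u
    by (auto simp: inner_weight_def edge_weight_nonneg edge_weight_sym)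
  show "inner_weight A v summable_on V"
    by (rule summable_on_comparison_test[OF edge_weight_summable])
      (auto simp: inner_weight_def edge_weight_nonneg)
  define S where "S = (if v \<in> A then A else B)"
  have S: "(\<Sum>\<^sub>\<infinity>u\<in>V. inner_weight A v u) = (\<Sum>\<^sub>\<infinity>u\<in>S. w v u)"
    using AB v by (intro infsum_cong_neutral) (auto simp: inner_weight_def S_def split: if_splits)
  also have "\<dots> = trans_prob V E m S v * \<mu> v" by (rule trans_prob_eq[OF v])
  also have "\<dots> \<le> kappa_partition V E m A B * \<mu> v"
    using trans_prob_le_kappa_partition[OF AB(1) v] AB v vertex_weight_pos[OF v]
    by (intro mult_right_mono) (auto simp: S_def)
  finally show "(\<Sum>\<^sub>\<infinity>u\<in>V. inner_weight A v u) \<le> kappa_partition V E m A B * \<mu> v" .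
next
  obtain v where v: "v \<in> V"
    using graph by (auto simp: summable_weighted_graph_def weighted_graph_def)
  have "0 \<le> trans_prob V E m S v" for S
    unfolding trans_prob_def using vertex_weight_pos[OF v]
    by (intro mult_nonneg_nonneg infsum_nonneg edge_weight_nonneg) auto
  from this[of A] this[of B] show "0 \<le> kappa_partition V E m A B"
    using trans_prob_le_kappa_partition[OF AB(1) v] AB v by fastforce
qed

text \<open>The slack \<open>e\<close> is the error of the approximate eigenvector \<open>f\<close>
  for \<open>x\<close>, since a spectral point need not be an eigenvalue; \<open>D f\<close> is then
  tested against \<open>reflection x\<close>.\<close>

lemma spectrum_near_reflection:
  assumes AB: "A \<union> B = V" "A \<inter> B = {}"
    and x: "x \<in> averaging.spectrum (laplacian V E m)" and e: "0 < e"
  obtains t where "t \<in> averaging.spectrum (laplacian V E m)"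
    "\<bar>t - reflection x\<bar> < 2 * kappa_partition V E m A B + e"
proof -
  interpret inner: schur_kernel V \<mu> "inner_weight A" "kappa_partition V E m A B"
    by (rule schur_kernel_inner_weight[OF AB])
  let ?L = "laplacian V E m" and ?\<kappa> = "kappa_partition V E m A B"
  obtain f where f: "f \<in> wl2 V \<mu>" "averaging.nrm f \<noteq> 0"
      "averaging.nrm (averaging.shift ?L x f) < e * averaging.nrm f"
    using averaging.spectrum_approximate_eigenvector[OF bounded_operator_laplacian
        self_adjoint_laplacian x e] by blast
  define D where "D v = (if v \<in> A then 1 else - 1 :: real)" for v
  have DD: "(D v)\<^sup>2 = 1" "D v * D v = 1" for v by (auto simp: D_def)
  have D_mem: "(\<lambda>v. D v * h v) \<in> wl2 V \<mu>" if "h \<in> wl2 V \<mu>" for h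
    using that by (auto simp: wl2_def power_mult_distrib DD)
  have D_nrm: "averaging.nrm (\<lambda>v. D v * h v) = averaging.nrm h" for h
    by (simp add: averaging.nrm_def wip_self power_mult_distrib DD)
  define g where "g v = D v * f v" for v
  have g: "g \<in> wl2 V \<mu>" unfolding g_def[abs_def] by (rule D_mem[OF f(1)])
  define r where "r = (\<lambda>v. averaging.shift ?L x f v + 2 * inner.kernel_op f v)"
  \<comment> \<open>In operator form \<open>D P D = 2 P' - P\<close>: conjugation keeps the
    transitions inside the parts and negates those between them.\<close>
  have conj: "averaging.kernel_op g v = D v * (2 * inner.kernel_op f v - averaging.kernel_op f v)" for v
  proof (cases "v \<in> V")
    case v: True
    have "2 * (\<Sum>\<^sub>\<infinity>u\<in>V. inner_weight A v u * f u)
        = (\<Sum>\<^sub>\<infinity>u\<in>V. D v * (w v u * g u) + w v u * f u)"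
      unfolding infsum_cmult_right'[symmetric]
      by (intro infsum_cong) (auto simp: g_def D_def inner_weight_def)
    also have "\<dots> = D v * (\<Sum>\<^sub>\<infinity>u\<in>V. w v u * g u) + (\<Sum>\<^sub>\<infinity>u\<in>V. w v u * f u)"
      unfolding infsum_cmult_right'[symmetric]
      by (intro infsum_add summable_on_cmult_right averaging.row_mult_summable f g v)
    finally have "2 * inner.kernel_op f v = D v * averaging.kernel_op g v + averaging.kernel_op f v"
      using v by (simp add: averaging.kernel_op_def inner.kernel_op_def add_divide_distrib[symmetric])
    then show ?thesis
      by (simp add: DD(2) mult.assoc[symmetric])
  qed (simp add: averaging.kernel_op_def inner.kernel_op_def)
  have shift_mem: "averaging.shift ?L x f \<in> wl2 V \<mu>"
    by (rule averaging.op_mem[OF averaging.bounded_operator_shift[OF bounded_operator_laplacian] f(1)])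
  have r_mem: "r \<in> wl2 V \<mu>"
    unfolding r_def
    by (intro averaging.add_mem averaging.scale_mem shift_mem inner.kernel_op_bound(1) f(1))
  \<comment> \<open>The residual of \<open>g\<close> for \<open>2 - x\<close> is, up to the signs
    \<open>- D v\<close>, the residual of \<open>f\<close> for \<open>x\<close> plus
    \<open>2 P' f\<close>.\<close>
  have shift_g: "averaging.shift ?L (reflection x) g = (\<lambda>v. - 1 * (D v * r v))"
    unfolding averaging.shift_def r_def laplacian_eq[OF g] laplacian_eq[OF f(1)] conj
    by (auto simp: g_def reflection_def algebra_simps)
  have "averaging.nrm (averaging.shift ?L (reflection x) g) = averaging.nrm r"
    unfolding shift_g by (subst averaging.nrm_scale[OF D_mem[OF r_mem]]) (simp add: D_nrm)
  also have "\<dots> \<le> averaging.nrm (averaging.shift ?L x f) + 2 * averaging.nrm (inner.kernel_op f)"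
    unfolding r_def
    using averaging.nrm_triangle[OF shift_mem averaging.scale_mem[OF inner.kernel_op_bound(1)[OF f(1)]], of 2]
      averaging.nrm_scale[OF inner.kernel_op_bound(1)[OF f(1)], of 2] by simp
  also have "\<dots> < (2 * ?\<kappa> + e) * averaging.nrm g"
    using f(3) inner.kernel_op_bound(2)[OF f(1)]
    unfolding g_def[abs_def] D_nrm by (simp add: algebra_simps)
  finally show thesis
    using averaging.spectrum_near_approximate_eigenvalue[OF bounded_operator_laplacian
        self_adjoint_laplacian g, of "reflection x"] f(2) that
    unfolding g_def[abs_def] D_nrm by blast
qed

text \<open>The two ends of an edge differ, so one vertex can be split off. This keeps the infimum
  in \<open>kappa\<close> from ranging over the empty set.\<close>

lemma exists_partition:
  obtains A B where "A \<union> B = V" "A \<inter> B = {}" "A \<noteq> {}" "B \<noteq> {}"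
proof -
  obtain v where v: "v \<in> V"
    using graph by (auto simp: summable_weighted_graph_def weighted_graph_def)
  then obtain u where u: "u \<in> V" "{v, u} \<in> E"
    using no_isolated by (auto simp: no_isolated_vertices_def)
  then have "card {v, u} = 2"
    using graph by (auto simp: summable_weighted_graph_def weighted_graph_def)
  then have "v \<noteq> u" by auto
  then show thesis using that[of "{v}" "V - {v}"] u v by auto
qed

text \<open>The point mass at a vertex \<open>v\<close> has squared norm \<open>\<mu> v\<close>,
  which is positive.\<close>

lemma spectrum_laplacian_nonempty: "averaging.spectrum (laplacian V E m) \<noteq> {}"
proof -
  obtain v where v: "v \<in> V"
    using graph by (auto simp: summable_weighted_graph_def weighted_graph_def)
  let ?f = "\<lambda>u. if u = v then 1 else 0 :: real"
  have eq: "(\<lambda>u. \<mu> u * (?f u)\<^sup>2) = (\<lambda>u. if u = v then \<mu> u else 0)" by auto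
  have "((\<lambda>u. if u = v then \<mu> u else 0) has_sum \<mu> v) V"
    by (rule has_sum_finite_neutralI[of "{v}"]) (use v in auto)
  then have "(\<lambda>u. \<mu> u * (?f u)\<^sup>2) summable_on V" and "wip V \<mu> ?f ?f = \<mu> v"
    unfolding wip_self eq by (rule has_sum_imp_summable, rule infsumI)
  moreover from this have "?f \<in> wl2 V \<mu>"
    using v by (auto simp: wl2_def)
  ultimately show ?thesis
    using vertex_weight_pos[OF v]
    by (intro averaging.spectrum_nonempty[OF bounded_operator_laplacian self_adjoint_laplacian, of ?f])
      (auto simp: averaging.nrm_def)
qed

end

theorem theorem7p1:
  fixes V :: "'a set" and E :: "'a set set" and m :: "'a set \<Rightarrow> real"
  assumes "summable_weighted_graph V E m"
    and "no_isolated_vertices V E"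
  shows "hausdorff_distance (L2_spectrum V E m (laplacian V E m))
           (reflection ` L2_spectrum V E m (laplacian V E m)) \<le> 2 * kappa V E m"
proof -
  interpret summable_graph V E m by (rule summable_graph.intro[OF assms])
  let ?\<sigma> = "averaging.spectrum (laplacian V E m)"
  \<comment> \<open>Halving the distance gives a lower bound for the very set whose infimum is
    \<open>kappa V E m\<close>.\<close>
  have "hausdorff_distance ?\<sigma> (reflection ` ?\<sigma>) / 2 \<le> kappa_partition V E m A B"
    if AB: "A \<union> B = V" "A \<inter> B = {}" for A B
  proof -
    have "hausdorff_distance ?\<sigma> (reflection ` ?\<sigma>) \<le> 2 * kappa_partition V E m A B"
    proof (rule hausdorff_distance_reflection_le[OF spectrum_laplacian_nonempty])
      fix x assume x: "x \<in> ?\<sigma>"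
      show "infdist (reflection x) ?\<sigma> \<le> 2 * kappa_partition V E m A B"
      \<comment> \<open>The slack of the approximate eigenvectors is sent to zero while the
        partition stays fixed.\<close>
      proof (rule field_le_epsilon)
        fix e :: real assume "0 < e"
        then obtain t where t: "t \<in> ?\<sigma>" "\<bar>t - reflection x\<bar> < 2 * kappa_partition V E m A B + e"
          using spectrum_near_reflection[OF AB x] by blast
        then show "infdist (reflection x) ?\<sigma> \<le> 2 * kappa_partition V E m A B + e"
          using infdist_le[OF t(1), of "reflection x"] by (simp add: dist_real_def abs_minus_commute)
      qed
    qed
    then show ?thesis by simp
  qed
  then have "hausdorff_distance ?\<sigma> (reflection ` ?\<sigma>) / 2 \<le> kappa V E m"
    unfolding kappa_def
  proof (intro cInf_greatest)
    show "{kappa_partition V E m A B | A B. A \<union> B = V \<and> A \<inter> B = {} \<and> A \<noteq> {} \<and> B \<noteq> {}} \<noteq> {}"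
      by (rule exists_partition) auto
  qed auto
  then show ?thesis by (simp add: L2_spectrum_eq)
qed

end
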